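(* Assume (A2), (A3) and (P1). Then there is a constant $c$, independent of $N$, such that for every data vector $y$ the (unique) solution $(X,U)$ of the quadratic program (QP) satisfies $$\|X\|_\omega\le c\|y\|_\infty\quad\text{and}\quad\|U\|_\omega\le c\|y\|_\infty,$$ where $\|X\|_\omega^2=|X_N|^2+\sum_{i=1}^N\omega_i|X_i|^2$, $\|U\|_\omega^2=\sum_{i=1}^N\omega_i|U_i|^2$, and $\|y\|_\infty$ is the maximum Euclidean norm of the blocks $y_{11},\dots,y_{1N},y_2,y_3,y_{41},\dots,y_{4,N-1},y_5,y_{61},\dots,y_{6N}$.
   Context: Radau collocation data: for an integer $N\ge 2$, let $-1<\tau_1<\dots<\tau_N=1$ and $\omega_1,\dots,\omega_N>0$ be the nodes and weights of the $N$-point Gauss–Radau quadrature rule on $[-1,1]$ with fixed node $+1$ ($\sum_i\omega_i=2$). Set $\tau_0=-1$. For $0\le j\le N$ let $L_j(\tau)=\prod_{i=0,i\ne j}^{N}\frac{\tau-\tau_i}{\tau_j-\tau_i}$ and let $D$ be the $N\times(N+1)$ matrix $D_{ij}=L_j'(\tau_i)$, $1\le i\le N$, $0\le j\le N$; $D_{1:N}$ is the submatrix of columns $1,\dots,N$. Matrix $\|\cdot\|_\infty$ is the largest absolute row sum; $|\cdot|$ is the Euclidean norm. (P1): $D_{1:N}$ is invertible and $\|D_{1:N}^{-1}\|_\infty\le2$. Problem data: $f:\mathbb{R}^n\times\mathbb{R}^m\to\mathbb{R}^n$, $C:\mathbb{R}^n\to\mathbb{R}$ twice continuously differentiable near the relevant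 points, $H(x,u,\lambda)=\lambda^{\mathsf T}f(x,u)$, and $(x^*,u^*,\lambda^* )$ a given continuous triple on $[-1,1]$. With $H$-derivatives evaluated at $(x^*(\tau_i),u^*(\tau_i),\lambda^*(\tau_i))$: $A_i=\nabla_xf(x^*(\tau_i),u^*(\tau_i))$, $B_i=\nabla_uf(x^*(\tau_i),u^*(\tau_i))$, $Q_i=\nabla_{xx}H$, $S_i=\nabla_{xu}H$, $R_i=\nabla_{uu}H$, $T=\nabla^2C(x^*(1))$. (A2): for some $\alpha>0$ the smallest eigenvalues of $\nabla^2C(x^*(1))$ and of $\nabla^2_{(x,u)}H(x^*(t),u^*(t),\lambda^*(t))$ exceed $\alpha$ uniformly in $t\in[-1,1]$. (A3): $\|\nabla_xf(x^*(t),u^*(t))\|_\infty\le1/4$ and $\|\nabla_xf(x^*(t),u^*(t))^{\mathsf T}\|_\infty\le1/4$ for all $t$. Data $y$: $y_{1i}\in\mathbb{R}^n$ ($1\le i\le N$), $y_2,y_3,y_5\in\mathbb{R}^n$, $y_{4i}\in\mathbb{R}^n$ ($1\le i<N$), $y_{6i}\in\mathbb{R}^m$ ($1\le i\le N$); set $y_{4N}:=y_5$. (QP): minimize over $X=(X_0,\dots,X_N)$, $U=(U_1,\dots,U_N)$ the function $\tfrac12\mathcal{Q}(X,U)+\mathcal{L}(X,U)$ subject to $\sum_{j=0}^ND_{ij}X_j=A_iX_i+B_iU_i+y_{1i}$ ($1\le i\le N$), $X_0=y_2$, where $\mathcal{Q}(X,U)=X_N^{\mathsf T}TX_N+\sum_{i=1}^N\omega_i(X_i^{\mathsf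 T}Q_iX_i+2X_i^{\mathsf T}S_iU_i+U_i^{\mathsf T}R_iU_i)$ and $\mathcal{L}(X,U)=X_0^{\mathsf T}\big(y_3+\sum_{i=1}^N\omega_iy_{4i}\big)-\sum_{i=1}^N\omega_i(y_{4i}^{\mathsf T}X_i+y_{6i}^{\mathsf T}U_i)$. *)

theory Defs
  imports "HOL-Analysis.Analysis" "HOL-Computational_Algebra.Polynomial"
begin

section \<open>Gauss--Radau collocation data\<close>

text \<open>tau 0 = -1 is the convention tau_0 = -1; tau 1 .. tau N are the N Gauss--Radau
  nodes with fixed node +1 and omega 1 .. omega N the weights.  The N-point
  Gauss--Radau rule with fixed node +1 is characterised as the (unique) N-point rule
  with nodes -1 < tau_1 < ... < tau_N = 1 that is exact for all polynomials of
  degree at most 2N-2.\<close>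
definition gauss_radau :: "nat \<Rightarrow> (nat \<Rightarrow> real) \<Rightarrow> (nat \<Rightarrow> real) \<Rightarrow> bool" where
  "gauss_radau N tau omega \<longleftrightarrow>
     tau 0 = -1 \<and> -1 < tau 1 \<and> tau N = 1 \<and>
     (\<forall>i\<in>{1..<N}. tau i < tau (Suc i)) \<and>
     (\<forall>i\<in>{1..N}. 0 < omega i) \<and>
     (\<forall>p :: real poly. degree p \<le> 2 * N - 2 \<longrightarrow>
        (\<Sum>i=1..N. omega i * poly p (tau i)) = integral {-1..1} (poly p))"

definition lagrange_basis :: "nat \<Rightarrow> (nat \<Rightarrow> real) \<Rightarrow> nat \<Rightarrow> real \<Rightarrow> real" where
  "lagrange_basis N tau j t = (\<Prod>i\<in>{0..N} - {j}. (t - tau i) / (tau j - tau i))"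

text \<open>D i j = L_j'(tau_i), 1 <= i <= N, 0 <= j <= N.\<close>
definition radau_D :: "nat \<Rightarrow> (nat \<Rightarrow> real) \<Rightarrow> nat \<Rightarrow> nat \<Rightarrow> real" where
  "radau_D N tau i j = deriv (lagrange_basis N tau j) (tau i)"

text \<open>(P1): the N x N submatrix D_{1:N} (columns 1..N) is invertible and its inverse
  has infinity norm (largest absolute row sum) at most 2.\<close>
definition radau_P1 :: "nat \<Rightarrow> (nat \<Rightarrow> real) \<Rightarrow> bool" where
  "radau_P1 N tau \<longleftrightarrow>
     (\<exists>M :: nat \<Rightarrow> nat \<Rightarrow> real.
        (\<forall>i\<in>{1..N}. \<forall>k\<in>{1..N}.
            (\<Sum>j=1..N. radau_D N tau i j * M j k) = (if i = k then 1 else 0)) \<and>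
        (\<forall>i\<in>{1..N}. \<forall>k\<in>{1..N}.
            (\<Sum>j=1..N. M i j * radau_D N tau j k) = (if i = k then 1 else 0)) \<and>
        (\<forall>i\<in>{1..N}. (\<Sum>j=1..N. \<bar>M i j\<bar>) \<le> 2))"

section \<open>Matrix and calculus notions\<close>

definition mat_norm_inf :: "real^'n^'m \<Rightarrow> real" where
  "mat_norm_inf M = Max (range (\<lambda>i. \<Sum>j\<in>UNIV. \<bar>M $ i $ j\<bar>))"

definition mat_eigenvalue :: "real^'n^'n \<Rightarrow> real \<Rightarrow> bool" where
  "mat_eigenvalue M k \<longleftrightarrow> (\<exists>v. v \<noteq> 0 \<and> M *v v = k *\<^sub>R v)"

definition partial_at :: "(real^'n \<Rightarrow> real) \<Rightarrow> real^'n \<Rightarrow> 'n \<Rightarrow> real" where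
  "partial_at g z i = deriv (\<lambda>s. g (z + s *\<^sub>R axis i 1)) 0"

text \<open>Hessian matrix: entry (i,j) is the second partial derivative d_i d_j g.\<close>
definition hess_mat :: "(real^'n \<Rightarrow> real) \<Rightarrow> real^'n \<Rightarrow> real^'n^'n" where
  "hess_mat g z = (\<chi> i j. partial_at (\<lambda>w. partial_at g w j) z i)"

text \<open>Twice continuously differentiable on an open set G (Frechet derivatives).\<close>
definition C2_on :: "'a::euclidean_space set \<Rightarrow> ('a \<Rightarrow> 'b::euclidean_space) \<Rightarrow> bool" where
  "C2_on G g \<longleftrightarrow> open G \<and>
     (\<exists>g' :: 'a \<Rightarrow> 'a \<Rightarrow>\<^sub>L 'b. \<exists>g'' :: 'a \<Rightarrow> 'a \<Rightarrow>\<^sub>L ('a \<Rightarrow>\<^sub>L 'b).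
        (\<forall>z\<in>G. (g has_derivative blinfun_apply (g' z)) (at z)) \<and>
        (\<forall>z\<in>G. (g' has_derivative blinfun_apply (g'' z)) (at z)) \<and>
        continuous_on G g'')"

section \<open>(x,u) space as real^('n + 'm)\<close>

definition xpart :: "real^('n::finite + 'm::finite) \<Rightarrow> real^'n" where
  "xpart z = (\<chi> i. z $ Inl i)"

definition upart :: "real^('n::finite + 'm::finite) \<Rightarrow> real^'m" where
  "upart z = (\<chi> j. z $ Inr j)"

definition joinxu :: "real^'n::finite \<Rightarrow> real^'m::finite \<Rightarrow> real^('n + 'm)" where
  "joinxu x u = (\<chi> k. case k of Inl i \<Rightarrow> x $ i | Inr j \<Rightarrow> u $ j)"

section \<open>Linearisation along (x*, u*, lambda*)\<close>

definition Amat :: "(real^'n \<Rightarrow> real^'m \<Rightarrow> real^'n) \<Rightarrow> (real \<Rightarrow> real^'n) \<Rightarrow> (real \<Rightarrow> real^'m)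
    \<Rightarrow> real \<Rightarrow> real^'n^'n" where
  "Amat f xs us t = jacobian (\<lambda>x. f x (us t)) (at (xs t))"

definition Bmat :: "(real^'n \<Rightarrow> real^'m \<Rightarrow> real^'n) \<Rightarrow> (real \<Rightarrow> real^'n) \<Rightarrow> (real \<Rightarrow> real^'m)
    \<Rightarrow> real \<Rightarrow> real^'m^'n" where
  "Bmat f xs us t = jacobian (\<lambda>u. f (xs t) u) (at (us t))"

text \<open>Hessian of H(x,u,lambda) = lambda^T f(x,u) with respect to (x,u).\<close>
definition HessH :: "(real^'n \<Rightarrow> real^'m \<Rightarrow> real^'n) \<Rightarrow> (real \<Rightarrow> real^'n) \<Rightarrow> (real \<Rightarrow> real^'m)
    \<Rightarrow> (real \<Rightarrow> real^'n) \<Rightarrow> real \<Rightarrow> real^('n + 'm)^('n + 'm)" where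
  "HessH f xs us ls t =
     hess_mat (\<lambda>z. ls t \<bullet> f (xpart z) (upart z)) (joinxu (xs t) (us t))"

definition Qmat where "Qmat f xs us ls t = (\<chi> i j. HessH f xs us ls t $ Inl i $ Inl j)"
definition Smat where "Smat f xs us ls t = (\<chi> i j. HessH f xs us ls t $ Inl i $ Inr j)"
definition Rmat where "Rmat f xs us ls t = (\<chi> i j. HessH f xs us ls t $ Inr i $ Inr j)"

section \<open>The quadratic program (QP)\<close>

definition qp_feasible ::
  "(real^'n \<Rightarrow> real^'m \<Rightarrow> real^'n) \<Rightarrow> (real \<Rightarrow> real^'n) \<Rightarrow> (real \<Rightarrow> real^'m)
   \<Rightarrow> nat \<Rightarrow> (nat \<Rightarrow> real)
   \<Rightarrow> (nat \<Rightarrow> real^'n) \<Rightarrow> real^'n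
   \<Rightarrow> (nat \<Rightarrow> real^'n) \<Rightarrow> (nat \<Rightarrow> real^'m) \<Rightarrow> bool" where
  "qp_feasible f xs us N tau y1 y2 X U \<longleftrightarrow>
     (\<forall>i\<in>{1..N}. (\<Sum>j=0..N. radau_D N tau i j *\<^sub>R X j)
         = Amat f xs us (tau i) *v X i + Bmat f xs us (tau i) *v U i + y1 i) \<and>
     X 0 = y2"

text \<open>y4ext N y4 y5 i is y_{4i} for i < N and y_{4N} := y_5.\<close>
definition y4ext :: "nat \<Rightarrow> (nat \<Rightarrow> real^'n) \<Rightarrow> real^'n \<Rightarrow> nat \<Rightarrow> real^'n" where
  "y4ext N y4 y5 i = (if i = N then y5 else y4 i)"

definition qp_cost ::
  "(real^'n \<Rightarrow> real^'m \<Rightarrow> real^'n) \<Rightarrow> (real^'n \<Rightarrow> real)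
   \<Rightarrow> (real \<Rightarrow> real^'n) \<Rightarrow> (real \<Rightarrow> real^'m) \<Rightarrow> (real \<Rightarrow> real^'n)
   \<Rightarrow> nat \<Rightarrow> (nat \<Rightarrow> real) \<Rightarrow> (nat \<Rightarrow> real)
   \<Rightarrow> real^'n \<Rightarrow> (nat \<Rightarrow> real^'n) \<Rightarrow> real^'n \<Rightarrow> (nat \<Rightarrow> real^'m)
   \<Rightarrow> (nat \<Rightarrow> real^'n) \<Rightarrow> (nat \<Rightarrow> real^'m) \<Rightarrow> real" where
  "qp_cost f C xs us ls N tau omega y3 y4 y5 y6 X U =
     (let T = hess_mat C (xs 1);
          Qf = X N \<bullet> (T *v X N)
             + (\<Sum>i=1..N. omega i *
                 (X i \<bullet> (Qmat f xs us ls (tau i) *v X i)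
                  + 2 * (X i \<bullet> (Smat f xs us ls (tau i) *v U i))
                  + U i \<bullet> (Rmat f xs us ls (tau i) *v U i)));
          Lf = X 0 \<bullet> (y3 + (\<Sum>i=1..N. omega i *\<^sub>R y4ext N y4 y5 i))
             - (\<Sum>i=1..N. omega i * (y4ext N y4 y5 i \<bullet> X i + y6 i \<bullet> U i))
      in Qf / 2 + Lf)"

definition qp_solution ::
  "(real^'n \<Rightarrow> real^'m \<Rightarrow> real^'n) \<Rightarrow> (real^'n \<Rightarrow> real)
   \<Rightarrow> (real \<Rightarrow> real^'n) \<Rightarrow> (real \<Rightarrow> real^'m) \<Rightarrow> (real \<Rightarrow> real^'n)
   \<Rightarrow> nat \<Rightarrow> (nat \<Rightarrow> real) \<Rightarrow> (nat \<Rightarrow> real)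
   \<Rightarrow> (nat \<Rightarrow> real^'n) \<Rightarrow> real^'n \<Rightarrow> real^'n \<Rightarrow> (nat \<Rightarrow> real^'n) \<Rightarrow> real^'n
   \<Rightarrow> (nat \<Rightarrow> real^'m)
   \<Rightarrow> (nat \<Rightarrow> real^'n) \<Rightarrow> (nat \<Rightarrow> real^'m) \<Rightarrow> bool" where
  "qp_solution f C xs us ls N tau omega y1 y2 y3 y4 y5 y6 X U \<longleftrightarrow>
     qp_feasible f xs us N tau y1 y2 X U \<and>
     (\<forall>X' U'. qp_feasible f xs us N tau y1 y2 X' U' \<longrightarrow>
        qp_cost f C xs us ls N tau omega y3 y4 y5 y6 X U
          \<le> qp_cost f C xs us ls N tau omega y3 y4 y5 y6 X' U')"

section \<open>Norms\<close>

definition normX_omega :: "nat \<Rightarrow> (nat \<Rightarrow> real) \<Rightarrow> (nat \<Rightarrow> real^'n) \<Rightarrow> real" where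
  "normX_omega N omega X = sqrt ((norm (X N))\<^sup>2 + (\<Sum>i=1..N. omega i * (norm (X i))\<^sup>2))"

definition normU_omega :: "nat \<Rightarrow> (nat \<Rightarrow> real) \<Rightarrow> (nat \<Rightarrow> real^'m) \<Rightarrow> real" where
  "normU_omega N omega U = sqrt (\<Sum>i=1..N. omega i * (norm (U i))\<^sup>2)"

definition data_norm ::
  "nat \<Rightarrow> (nat \<Rightarrow> real^'n) \<Rightarrow> real^'n \<Rightarrow> real^'n \<Rightarrow> (nat \<Rightarrow> real^'n) \<Rightarrow> real^'n
   \<Rightarrow> (nat \<Rightarrow> real^'m) \<Rightarrow> real" where
  "data_norm N y1 y2 y3 y4 y5 y6 =
     Max ((\<lambda>i. norm (y1 i)) ` {1..N} \<union> {norm y2, norm y3, norm y5}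
          \<union> (\<lambda>i. norm (y4 i)) ` {1..<N} \<union> (\<lambda>i. norm (y6 i)) ` {1..N})"

end

theory Submission
  imports Defs
begin

(* The solution (X, U) of (QP) costs no more than the feasible point (Xh, 0) obtained by solving
   the collocation equations with zero control.  Writing Xh_j = y_2 + V_j, these equations read
   V = D_{1:N}^{-1} (A V + r) because the rows of D annihilate constants, and by (P1) and (A3)
   the right-hand side is a contraction with factor 1/2 in the maximum norm; hence
   |Xh_j| <= (1 + 5 sqrt n) |y|.  By (A2) (eigenvalues of the Hessians, which are symmetric by
   Schwarz's theorem) the quadratic part of the cost dominates alpha (|X|_w^2 + |U|_w^2), while
   the linear part is absorbed by Young's inequality.  Comparing the two costs bounds
   |X|_w^2 + |U|_w^2 by a multiple of |y|^2 that depends on alpha, on bounds for the Hessians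
   along the trajectory and on n, but not on N. *)

section \<open>Lagrange basis and Gauss--Radau collocation\<close>

definition lagrange_basis_poly :: "nat \<Rightarrow> (nat \<Rightarrow> real) \<Rightarrow> nat \<Rightarrow> real poly" where
  "lagrange_basis_poly N tau j = (\<Prod>i\<in>{0..N} - {j}. smult (1 / (tau j - tau i)) [:- tau i, 1:])"

lemma lagrange_basis_eq_poly: "lagrange_basis N tau j = poly (lagrange_basis_poly N tau j)"
  unfolding lagrange_basis_def lagrange_basis_poly_def fun_eq_iff poly_prod
  by (intro allI prod.cong) (simp_all add: diff_divide_distrib)

lemma degree_lagrange_basis_poly: "degree (lagrange_basis_poly N tau j) \<le> N"
  if "j \<le> N"
proof -
  have "degree (lagrange_basis_poly N tau j) \<le> (\<Sum>i\<in>{0..N} - {j}. 1)"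
    unfolding lagrange_basis_poly_def
    by (rule order_trans[OF degree_prod_sum_le sum_mono]) (auto intro: order_trans[OF degree_smult_le])
  also have "\<dots> = N" using that by simp
  finally show ?thesis .
qed

lemma lagrange_basis_node:
  assumes "inj_on tau {0..N}" "j \<le> N" "k \<le> N"
  shows "lagrange_basis N tau j (tau k) = (if j = k then 1 else 0)"
proof (cases "j = k")
  case True
  have "tau j \<noteq> tau i" if "i \<in> {0..N} - {j}" for i
    using assms that by (auto dest: inj_onD)
  then show ?thesis using True by (auto simp: lagrange_basis_def intro!: prod.neutral)
next
  case False
  then show ?thesis using assms by (auto simp: lagrange_basis_def intro!: prod_zero bexI[of _ k])
qed

lemma sum_lagrange_basis_poly:
  assumes inj: "inj_on tau {0..N}"
  shows "(\<Sum>j=0..N. lagrange_basis_poly N tau j) = 1"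
proof (rule poly_eqI_degree[where A = "tau ` {0..N}"])
  have card: "card (tau ` {0..N}) = Suc N" using inj by (simp add: card_image)
  have "degree (\<Sum>j=0..N. lagrange_basis_poly N tau j) \<le> N"
    by (intro degree_sum_le) (auto intro: degree_lagrange_basis_poly)
  then show "degree (\<Sum>j=0..N. lagrange_basis_poly N tau j) < card (tau ` {0..N})"
    using card by simp
  show "degree (1 :: real poly) < card (tau ` {0..N})" using card by simp
  fix x assume "x \<in> tau ` {0..N}"
  then obtain k where k: "k \<le> N" "x = tau k" by auto
  have "poly (\<Sum>j=0..N. lagrange_basis_poly N tau j) x = (\<Sum>j=0..N. lagrange_basis N tau j (tau k))"
    by (simp add: poly_sum lagrange_basis_eq_poly k)
  also have "\<dots> = (\<Sum>j=0..N. if j = k then 1 else 0)"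
    using inj k by (intro sum.cong) (auto simp: lagrange_basis_node)
  finally show "poly (\<Sum>j=0..N. lagrange_basis_poly N tau j) x = poly 1 x" using k by simp
qed

lemma radau_D_eq_pderiv: "radau_D N tau i j = poly (pderiv (lagrange_basis_poly N tau j)) (tau i)"
  unfolding radau_D_def lagrange_basis_eq_poly by (rule DERIV_imp_deriv) (rule poly_DERIV)

lemma radau_D_row_sum:
  assumes "inj_on tau {0..N}"
  shows "(\<Sum>j=0..N. radau_D N tau i j) = 0"
  using sum_lagrange_basis_poly[OF assms] higher_pderiv_sum[of 1 "lagrange_basis_poly N tau" "{0..N}"]
  by (simp add: radau_D_eq_pderiv flip: poly_sum)

lemma sum_scaleR_right_inverse:
  fixes w :: "'i \<Rightarrow> 'a::real_vector"
  assumes "finite I" "i \<in> I"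
    and inv: "\<And>i k. i \<in> I \<Longrightarrow> k \<in> I \<Longrightarrow> (\<Sum>j\<in>I. D i j * M j k) = (if i = k then 1 else 0)"
  shows "(\<Sum>j\<in>I. D i j *\<^sub>R (\<Sum>k\<in>I. M j k *\<^sub>R w k)) = w i"
proof -
  have "(\<Sum>j\<in>I. D i j *\<^sub>R (\<Sum>k\<in>I. M j k *\<^sub>R w k)) = (\<Sum>j\<in>I. \<Sum>k\<in>I. (D i j * M j k) *\<^sub>R w k)"
    by (simp add: scaleR_sum_right)
  also have "\<dots> = (\<Sum>k\<in>I. (\<Sum>j\<in>I. D i j * M j k) *\<^sub>R w k)"
    by (subst sum.swap) (simp add: scaleR_sum_left)
  also have "\<dots> = (\<Sum>k\<in>I. if k = i then w k else 0)"
    using assms by (intro sum.cong) auto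
  finally show ?thesis using assms by simp
qed

lemma sum_scaleR_eq_sum_differences:
  fixes X :: "nat \<Rightarrow> 'a::real_vector"
  assumes "(\<Sum>j=0..N. c j) = 0"
  shows "(\<Sum>j=0..N. c j *\<^sub>R X j) = (\<Sum>j=1..N. c j *\<^sub>R (X j - X 0))"
proof -
  have "(\<Sum>j=0..N. c j *\<^sub>R (X j - X 0)) = (\<Sum>j=0..N. c j *\<^sub>R X j) - (\<Sum>j=0..N. c j) *\<^sub>R X 0"
    by (simp add: scaleR_diff_right sum_subtractf scaleR_sum_left)
  then show ?thesis using assms by (simp add: sum.atLeast_Suc_atMost)
qed

lemma gauss_radau_strict_mono:
  assumes "gauss_radau N tau omega" "i < j" "j \<le> N"
  shows "tau i < tau j"
  using assms(2,3)
proof (induction j)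
  case (Suc j)
  have "tau j < tau (Suc j)"
    using assms(1) Suc.prems by (cases "j = 0") (auto simp: gauss_radau_def)
  then show ?case using Suc by (cases "i = j") auto
qed simp

lemma gauss_radau_inj_on: "gauss_radau N tau omega \<Longrightarrow> inj_on tau {0..N}"
  by (rule inj_onI) (metis atLeastAtMost_iff gauss_radau_strict_mono less_irrefl nat_neq_iff)

lemma gauss_radau_node_range:
  assumes gr: "gauss_radau N tau omega" and "i \<le> N"
  shows "tau i \<in> {-1..1}"
proof -
  have "tau 0 \<le> tau i"
    using gauss_radau_strict_mono[OF gr, of 0 i] \<open>i \<le> N\<close> by (cases "i = 0") auto
  moreover have "tau i \<le> tau N"
    using gauss_radau_strict_mono[OF gr, of i N] \<open>i \<le> N\<close> by (cases "i = N") auto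
  ultimately show ?thesis using gr by (simp add: gauss_radau_def)
qed

lemma gauss_radau_weight_sum:
  assumes "gauss_radau N tau omega"
  shows "(\<Sum>i=1..N. omega i) = 2"
proof -
  have "(\<Sum>i=1..N. omega i * poly 1 (tau i)) = integral {-1..1} (poly (1 :: real poly))"
    using assms unfolding gauss_radau_def by (metis degree_1 zero_le)
  moreover have "poly (1 :: real poly) = (\<lambda>x. 1)" by auto
  ultimately show ?thesis by (simp add: integral_const_real)
qed

lemma gauss_radau_weight_pos: "gauss_radau N tau omega \<Longrightarrow> i \<in> {1..N} \<Longrightarrow> 0 < omega i"
  by (simp add: gauss_radau_def)

section \<open>Contractions in the maximum norm\<close>

lemma infnorm_le_cart:
  assumes "\<And>i. \<bar>x $ i\<bar> \<le> c"
  shows "infnorm (x :: real^'n) \<le> c"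
  unfolding infnorm_cart using assms by (intro cSup_least) auto

lemma infnorm_matrix_vector_mult_le:
  fixes A :: "real^'n^'m"
  shows "infnorm (A *v x) \<le> mat_norm_inf A * infnorm x"
proof (rule infnorm_le_cart)
  fix i
  have "\<bar>(A *v x) $ i\<bar> \<le> (\<Sum>j\<in>UNIV. \<bar>A $ i $ j\<bar> * infnorm x)"
    unfolding matrix_vector_mult_def
    by (auto intro!: order_trans[OF sum_abs sum_mono] mult_left_mono component_le_infnorm_cart
        simp: abs_mult)
  also have "\<dots> = (\<Sum>j\<in>UNIV. \<bar>A $ i $ j\<bar>) * infnorm x" by (simp add: sum_distrib_right)
  also have "\<dots> \<le> mat_norm_inf A * infnorm x"
    unfolding mat_norm_inf_def by (intro mult_right_mono Max_ge infnorm_pos_le) auto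
  finally show "\<bar>(A *v x) $ i\<bar> \<le> mat_norm_inf A * infnorm x" .
qed

lemma infnorm_sum_scaleR_le: "infnorm (\<Sum>j\<in>J. c j *\<^sub>R w j) \<le> (\<Sum>j\<in>J. \<bar>c j\<bar> * infnorm (w j))"
  by (induction J rule: infinite_finite_induct)
    (auto simp: infnorm_0 infnorm_mul intro!: order_trans[OF infnorm_triangle])

lemma infnorm_sum_scaleR_le_mult:
  assumes "(\<Sum>j\<in>J. \<bar>c j\<bar>) \<le> m" "\<And>j. j \<in> J \<Longrightarrow> infnorm (w j) \<le> B" "0 \<le> B"
  shows "infnorm (\<Sum>j\<in>J. c j *\<^sub>R w j) \<le> m * B"
proof -
  have "infnorm (\<Sum>j\<in>J. c j *\<^sub>R w j) \<le> (\<Sum>j\<in>J. \<bar>c j\<bar> * B)"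
    by (rule order_trans[OF infnorm_sum_scaleR_le sum_mono]) (simp add: mult_left_mono assms(2))
  also have "\<dots> \<le> m * B"
    using assms(1,3) by (simp add: mult_right_mono flip: sum_distrib_right)
  finally show ?thesis .
qed

lemma contraction_iterates_convergent:
  fixes \<Phi> :: "('i \<Rightarrow> 'a::euclidean_space) \<Rightarrow> 'i \<Rightarrow> 'a"
  assumes I: "finite I" and q: "0 \<le> q" "q < 1"
    and contr: "\<And>W W' B i. (\<And>j. j \<in> I \<Longrightarrow> infnorm (W j - W' j) \<le> B) \<Longrightarrow> i \<in> I
                  \<Longrightarrow> infnorm (\<Phi> W i - \<Phi> W' i) \<le> q * B"
    and i: "i \<in> I"
  shows "convergent (\<lambda>k. (\<Phi> ^^ k) (\<lambda>_. 0) i)"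
proof -
  define Vs where "Vs k = (\<Phi> ^^ k) (\<lambda>_. 0)" for k
  have Vs_Suc: "Vs (Suc k) = \<Phi> (Vs k)" for k by (simp add: Vs_def)
  define R where "R = (\<Sum>i\<in>I. infnorm (Vs 1 i - Vs 0 i))"
  have step: "infnorm (Vs (Suc k) i - Vs k i) \<le> q ^ k * R" if "i \<in> I" for k i
    using that
  proof (induction k arbitrary: i)
    case 0
    then show ?case using I by (auto simp: R_def intro!: member_le_sum infnorm_pos_le)
  next
    case (Suc k)
    then show ?case using contr[OF Suc.IH Suc.prems] by (simp add: Vs_Suc mult_ac)
  qed
  have "summable (\<lambda>k. Vs (Suc k) i - Vs k i)"
  proof (rule summable_comparison_test)
    show "\<exists>N0. \<forall>k\<ge>N0. norm (Vs (Suc k) i - Vs k i) \<le> sqrt DIM('a) * R * q ^ k"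
      using order_trans[OF norm_le_infnorm mult_left_mono[OF step[OF i]]] by (auto simp: mult_ac)
    show "summable (\<lambda>k. sqrt DIM('a) * R * q ^ k)"
      using q by (intro summable_mult summable_geometric) simp
  qed
  moreover have "(\<Sum>k<n. Vs (Suc k) i - Vs k i) = Vs n i" for n
    using sum_lessThan_telescope[of "\<lambda>k. Vs k i" n] by (simp add: Vs_def)
  ultimately show ?thesis by (simp add: summable_iff_convergent flip: Vs_def)
qed

text \<open>A contraction is continuous, so the limit of its iterates is a fixed point.\<close>
lemma infnorm_contraction_fixpoint:
  fixes \<Phi> :: "('i \<Rightarrow> 'a::euclidean_space) \<Rightarrow> 'i \<Rightarrow> 'a"
  assumes I: "finite I" and q: "0 \<le> q" "q < 1"
    and contr: "\<And>W W' B i. (\<And>j. j \<in> I \<Longrightarrow> infnorm (W j - W' j) \<le> B) \<Longrightarrow> i \<in> I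
                  \<Longrightarrow> infnorm (\<Phi> W i - \<Phi> W' i) \<le> q * B"
  obtains V where "\<And>i. i \<in> I \<Longrightarrow> \<Phi> V i = V i"
proof -
  define Vs where "Vs k = (\<Phi> ^^ k) (\<lambda>_. 0)" for k
  have Vs_Suc: "Vs (Suc k) = \<Phi> (Vs k)" for k by (simp add: Vs_def)
  have "convergent (\<lambda>k. Vs k i)" if "i \<in> I" for i
    unfolding Vs_def by (rule contraction_iterates_convergent[OF I q contr that])
  then obtain L where conv: "\<And>i. i \<in> I \<Longrightarrow> (\<lambda>k. Vs k i) \<longlonglongrightarrow> L i"
    unfolding convergent_def by metis
  have dist_to_L: "(\<lambda>k. \<Sum>j\<in>I. infnorm (Vs k j - L j)) \<longlonglongrightarrow> 0"
    using conv by (intro tendsto_null_sum) (auto intro!: tendsto_eq_intros simp: infnorm_0)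
  have "\<Phi> L i = L i" if i: "i \<in> I" for i
  proof (rule LIMSEQ_unique)
    show "(\<lambda>k. Vs (Suc k) i) \<longlonglongrightarrow> L i" using conv[OF i] by (rule LIMSEQ_Suc)
    have "(\<lambda>k. \<Phi> (Vs k) i - \<Phi> L i) \<longlonglongrightarrow> 0"
    proof (rule Lim_null_comparison)
      have "infnorm (\<Phi> (Vs k) i - \<Phi> L i) \<le> q * (\<Sum>j\<in>I. infnorm (Vs k j - L j))" for k
        using I by (intro contr[OF _ i] member_le_sum) (auto intro: infnorm_pos_le)
      then show "\<forall>\<^sub>F k in sequentially. norm (\<Phi> (Vs k) i - \<Phi> L i)
              \<le> sqrt DIM('a) * q * (\<Sum>j\<in>I. infnorm (Vs k j - L j))"
        by (intro always_eventually allI order_trans[OF norm_le_infnorm]) (simp add: mult.assoc)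
      show "(\<lambda>k. sqrt DIM('a) * q * (\<Sum>j\<in>I. infnorm (Vs k j - L j))) \<longlonglongrightarrow> 0"
        using tendsto_mult_right_zero[OF dist_to_L] by simp
    qed
    then show "(\<lambda>k. Vs (Suc k) i) \<longlonglongrightarrow> \<Phi> L i" by (simp add: Vs_Suc LIM_zero_iff)
  qed
  then show ?thesis using that by blast
qed

lemma affine_fixpoint_exists:
  fixes A :: "'i \<Rightarrow> real^'n^'n" and M :: "'i \<Rightarrow> 'i \<Rightarrow> real" and r :: "'i \<Rightarrow> real^'n"
  assumes I: "finite I"
    and M: "\<And>i. i \<in> I \<Longrightarrow> (\<Sum>j\<in>I. \<bar>M i j\<bar>) \<le> m"
    and A: "\<And>j. j \<in> I \<Longrightarrow> mat_norm_inf (A j) \<le> a"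
    and ma: "0 \<le> m" "0 \<le> a" "m * a < 1"
  obtains V where "\<And>i. i \<in> I \<Longrightarrow> V i = (\<Sum>j\<in>I. M i j *\<^sub>R (A j *v V j + r j))"
proof -
  define \<Phi> where "\<Phi> V i = (\<Sum>j\<in>I. M i j *\<^sub>R (A j *v V j + r j))" for V :: "'i \<Rightarrow> real^'n" and i
  have contr: "infnorm (\<Phi> W i - \<Phi> W' i) \<le> m * a * B"
    if WW': "\<And>j. j \<in> I \<Longrightarrow> infnorm (W j - W' j) \<le> B" and i: "i \<in> I" for W W' B i
  proof -
    have B: "0 \<le> B" using WW'[OF i] infnorm_pos_le order_trans by blast
    have "\<Phi> W i - \<Phi> W' i = (\<Sum>j\<in>I. M i j *\<^sub>R (A j *v (W j - W' j)))"
      by (simp add: \<Phi>_def matrix_vector_mult_diff_distrib flip: sum_subtractf scaleR_diff_right)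
    also have "infnorm \<dots> \<le> m * (a * B)"
      using M[OF i] A WW' ma B
      by (intro infnorm_sum_scaleR_le_mult mult_nonneg_nonneg
          order_trans[OF infnorm_matrix_vector_mult_le] mult_mono) (auto intro: infnorm_pos_le)
    finally show ?thesis by (simp add: mult_ac)
  qed
  obtain V where fixed: "\<And>i. i \<in> I \<Longrightarrow> \<Phi> V i = V i"
    using infnorm_contraction_fixpoint[of I "m * a" \<Phi>, OF I _ ma(3) contr] ma by auto
  show ?thesis
  proof (rule that)
    show "V i = (\<Sum>j\<in>I. M i j *\<^sub>R (A j *v V j + r j))" if "i \<in> I" for i
      using fixed[OF that] unfolding \<Phi>_def by (rule sym)
  qed
qed

lemma affine_fixpoint_infnorm_le:
  fixes A :: "'i \<Rightarrow> real^'n^'n" and M :: "'i \<Rightarrow> 'i \<Rightarrow> real" and r :: "'i \<Rightarrow> real^'n"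
  assumes I: "finite I"
    and M: "\<And>i. i \<in> I \<Longrightarrow> (\<Sum>j\<in>I. \<bar>M i j\<bar>) \<le> m"
    and A: "\<And>j. j \<in> I \<Longrightarrow> mat_norm_inf (A j) \<le> a"
    and r: "\<And>j. j \<in> I \<Longrightarrow> infnorm (r j) \<le> \<rho>"
    and ma: "0 \<le> m" "0 \<le> a" "m * a < 1"
    and V: "\<And>i. i \<in> I \<Longrightarrow> V i = (\<Sum>j\<in>I. M i j *\<^sub>R (A j *v V j + r j))"
    and i: "i \<in> I"
  shows "infnorm (V i) \<le> m * \<rho> / (1 - m * a)"
proof -
  define \<mu> where "\<mu> = Max ((\<lambda>j. infnorm (V j)) ` I)"
  have le_\<mu>: "infnorm (V j) \<le> \<mu>" if "j \<in> I" for j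
    using I that by (simp add: \<mu>_def)
  have "\<mu> \<in> (\<lambda>j. infnorm (V j)) ` I" unfolding \<mu>_def using I i by (intro Max_in) auto
  then obtain k where k: "k \<in> I" "\<mu> = infnorm (V k)" by blast
  have "0 \<le> \<rho>" using r[OF k(1)] infnorm_pos_le order_trans by blast
  have "\<mu> = infnorm (\<Sum>j\<in>I. M k j *\<^sub>R (A j *v V j + r j))"
    unfolding k(2) by (subst V[OF k(1)]) (rule refl)
  also have "\<dots> \<le> m * (a * \<mu> + \<rho>)"
    using M[OF k(1)] A r ma le_\<mu> k \<open>0 \<le> \<rho>\<close>
    by (intro infnorm_sum_scaleR_le_mult order_trans[OF infnorm_triangle] add_mono
        order_trans[OF infnorm_matrix_vector_mult_le] mult_mono add_nonneg_nonneg mult_nonneg_nonneg)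
      (auto intro: infnorm_pos_le order_trans)
  finally have "\<mu> * (1 - m * a) \<le> m * \<rho>" by (simp add: algebra_simps)
  then have "\<mu> \<le> m * \<rho> / (1 - m * a)" using ma by (simp add: pos_le_divide_eq)
  then show ?thesis using le_\<mu>[OF i] by linarith
qed

section \<open>Symmetry of second derivatives\<close>

lemma has_field_derivative_along_line:
  fixes g :: "'a::real_normed_vector \<Rightarrow> real"
  assumes "(g has_derivative g') (at (p + u *\<^sub>R v))"
  shows "((\<lambda>u. g (p + u *\<^sub>R v)) has_field_derivative g' v) (at u)"
proof -
  have "((\<lambda>u. p + u *\<^sub>R v) has_derivative (\<lambda>s. s *\<^sub>R v)) (at u)"
    by (auto intro!: derivative_eq_intros)
  from has_derivative_compose[OF this assms]
  have "((\<lambda>u. g (p + u *\<^sub>R v)) has_derivative (\<lambda>s. g' (s *\<^sub>R v))) (at u)" .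
  moreover have "(\<lambda>s. g' (s *\<^sub>R v)) = (*) (g' v)"
    using linear_scale[OF has_derivative_linear[OF assms]] by (auto simp: fun_eq_iff)
  ultimately show ?thesis by (simp add: has_field_derivative_def)
qed

lemma partial_at_eq_derivative:
  fixes g :: "real^'k \<Rightarrow> real"
  assumes "(g has_derivative g') (at z)"
  shows "partial_at g z j = g' (axis j 1)"
  unfolding partial_at_def
  by (rule DERIV_imp_deriv, rule has_field_derivative_along_line) (use assms in simp)

lemma hess_mat_eq_derivative:
  fixes g :: "real^'k \<Rightarrow> real"
  assumes S: "open S" "z \<in> S"
    and d1: "\<And>w. w \<in> S \<Longrightarrow> (g has_derivative g1 w) (at w)"
    and d2: "((\<lambda>w. g1 w (axis j 1)) has_derivative g2) (at z)"
  shows "hess_mat g z $ i $ j = g2 (axis i 1)"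
proof -
  let ?e = "axis i 1 :: real^'k"
  define S' where "S' = (\<lambda>s. z + s *\<^sub>R ?e) -` S"
  have "open S'" unfolding S'_def
    by (rule continuous_open_vimage[OF S(1)]) (intro continuous_intros)
  moreover have "0 \<in> S'" using S by (simp add: S'_def)
  moreover have "((\<lambda>s. g1 (z + s *\<^sub>R ?e) (axis j 1)) has_field_derivative g2 ?e) (at 0)"
    by (rule has_field_derivative_along_line) (use d2 in simp)
  ultimately have "((\<lambda>s. partial_at g (z + s *\<^sub>R ?e) j) has_field_derivative g2 ?e) (at 0)"
    by (elim has_field_derivative_transform_within_open[rotated 2])
       (auto simp: S'_def intro!: partial_at_eq_derivative[symmetric] d1)
  then show ?thesis
    unfolding hess_mat_def by (simp add: partial_at_def[of "\<lambda>w. partial_at g w j"] DERIV_imp_deriv)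
qed

lemma second_difference_mean_value:
  fixes g :: "'a::real_normed_vector \<Rightarrow> real"
  assumes s: "s > 0"
    and S: "\<And>u v. 0 \<le> u \<Longrightarrow> u \<le> s \<Longrightarrow> 0 \<le> v \<Longrightarrow> v \<le> s \<Longrightarrow> z + u *\<^sub>R a + v *\<^sub>R b \<in> S"
    and d1: "\<And>w. w \<in> S \<Longrightarrow> (g has_derivative g1 w) (at w)"
    and d2: "\<And>w h. w \<in> S \<Longrightarrow> ((\<lambda>w. g1 w h) has_derivative (\<lambda>k. g2 w k h)) (at w)"
  obtains \<xi> \<eta> where "0 < \<xi>" "\<xi> < s" "0 < \<eta>" "\<eta> < s"
    "g (z + s *\<^sub>R a + s *\<^sub>R b) - g (z + s *\<^sub>R a) - g (z + s *\<^sub>R b) + g z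
       = s\<^sup>2 * g2 (z + \<xi> *\<^sub>R a + \<eta> *\<^sub>R b) b a"
proof -
  define \<psi> where "\<psi> u = g ((z + s *\<^sub>R b) + u *\<^sub>R a) - g (z + u *\<^sub>R a)" for u
  have "\<exists>\<xi>>0. \<xi> < s \<and> \<psi> s - \<psi> 0
          = (s - 0) * (g1 ((z + s *\<^sub>R b) + \<xi> *\<^sub>R a) a - g1 (z + \<xi> *\<^sub>R a) a)"
  proof (rule MVT2[OF s])
    fix u assume u: "0 \<le> u" "u \<le> s"
    have "(z + s *\<^sub>R b) + u *\<^sub>R a \<in> S" "z + u *\<^sub>R a \<in> S"
      using S[of u s] S[of u 0] u s by (simp_all add: algebra_simps)
    then show "(\<psi> has_real_derivative (g1 ((z + s *\<^sub>R b) + u *\<^sub>R a) a - g1 (z + u *\<^sub>R a) a)) (at u)"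
      unfolding \<psi>_def by (intro DERIV_diff has_field_derivative_along_line) (use d1 in auto)
  qed
  then obtain \<xi> where \<xi>: "0 < \<xi>" "\<xi> < s"
    and e1: "\<psi> s - \<psi> 0 = s * (g1 ((z + \<xi> *\<^sub>R a) + s *\<^sub>R b) a - g1 ((z + \<xi> *\<^sub>R a) + 0 *\<^sub>R b) a)"
    by (auto simp: algebra_simps)
  have "\<exists>\<eta>>0. \<eta> < s \<and> g1 ((z + \<xi> *\<^sub>R a) + s *\<^sub>R b) a - g1 ((z + \<xi> *\<^sub>R a) + 0 *\<^sub>R b) a
          = (s - 0) * g2 ((z + \<xi> *\<^sub>R a) + \<eta> *\<^sub>R b) b a"
  proof (rule MVT2[OF s])
    fix v assume v: "0 \<le> v" "v \<le> s"
    have "(z + \<xi> *\<^sub>R a) + v *\<^sub>R b \<in> S" using S[of \<xi> v] v \<xi> by simp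
    then show "((\<lambda>v. g1 ((z + \<xi> *\<^sub>R a) + v *\<^sub>R b) a)
                 has_real_derivative g2 ((z + \<xi> *\<^sub>R a) + v *\<^sub>R b) b a) (at v)"
      by (intro has_field_derivative_along_line) (use d2 in simp)
  qed
  then obtain \<eta> where \<eta>: "0 < \<eta>" "\<eta> < s"
    and e2: "g1 ((z + \<xi> *\<^sub>R a) + s *\<^sub>R b) a - g1 ((z + \<xi> *\<^sub>R a) + 0 *\<^sub>R b) a
      = s * g2 ((z + \<xi> *\<^sub>R a) + \<eta> *\<^sub>R b) b a" by auto
  have "g (z + s *\<^sub>R a + s *\<^sub>R b) - g (z + s *\<^sub>R a) - g (z + s *\<^sub>R b) + g z = \<psi> s - \<psi> 0"
    by (simp add: \<psi>_def algebra_simps)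
  also have "\<dots> = s\<^sup>2 * g2 (z + \<xi> *\<^sub>R a + \<eta> *\<^sub>R b) b a"
    using e1 e2 by (simp add: power2_eq_square)
  finally show ?thesis using that \<xi> \<eta> by blast
qed

text \<open>Schwarz's theorem: both orders of the mean value theorem express the same second difference,
  and the two intermediate points tend to \<open>z\<close> with the step size.\<close>
lemma second_derivative_symmetric:
  fixes g :: "'a::real_normed_vector \<Rightarrow> real"
  assumes S: "open S" "z \<in> S"
    and d1: "\<And>w. w \<in> S \<Longrightarrow> (g has_derivative g1 w) (at w)"
    and d2: "\<And>w h. w \<in> S \<Longrightarrow> ((\<lambda>w. g1 w h) has_derivative (\<lambda>k. g2 w k h)) (at w)"
    and cont: "\<And>a b. isCont (\<lambda>w. g2 w a b) z"
  shows "g2 z a b = g2 z b a"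
proof -
  have "\<bar>g2 z a b - g2 z b a\<bar> \<le> e" if e: "e > 0" for e
  proof -
    obtain \<delta>1 where "\<delta>1 > 0" and cont_ab: "\<And>w. dist w z < \<delta>1 \<Longrightarrow> \<bar>g2 w a b - g2 z a b\<bar> < e / 2"
      using cont[of a b] e unfolding continuous_at_eps_delta dist_real_def by (meson half_gt_zero)
    obtain \<delta>2 where "\<delta>2 > 0" and cont_ba: "\<And>w. dist w z < \<delta>2 \<Longrightarrow> \<bar>g2 w b a - g2 z b a\<bar> < e / 2"
      using cont[of b a] e unfolding continuous_at_eps_delta dist_real_def by (meson half_gt_zero)
    obtain \<delta>3 where "\<delta>3 > 0" and ball: "ball z \<delta>3 \<subseteq> S" using S openE by blast
    define d where "d = min \<delta>1 (min \<delta>2 \<delta>3)"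
    define s where "s = d / (2 * (norm a + norm b + 1))"
    have "d > 0" using \<open>\<delta>1 > 0\<close> \<open>\<delta>2 > 0\<close> \<open>\<delta>3 > 0\<close> by (simp add: d_def)
    have "s > 0" using \<open>d > 0\<close> by (simp add: s_def add_nonneg_pos)
    have "s * (norm a + norm b) \<le> s * (2 * (norm a + norm b + 1)) / 2" using \<open>s > 0\<close> by simp
    also have "\<dots> < d" using \<open>d > 0\<close> by (simp add: s_def add_nonneg_pos)
    finally have s: "s > 0" "s * (norm a + norm b) < d" using \<open>s > 0\<close> by auto
    have near: "dist (z + u *\<^sub>R a + v *\<^sub>R b) z < d"
      if "0 \<le> u" "u \<le> s" "0 \<le> v" "v \<le> s" for u v
    proof -
      have "norm (u *\<^sub>R a + v *\<^sub>R b) \<le> s * norm a + s * norm b"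
        using that by (intro order_trans[OF norm_triangle_ineq] add_mono) (auto intro: mult_right_mono)
      then show ?thesis using s by (simp add: dist_norm add.assoc distrib_left)
    qed
    have near': "dist (z + u *\<^sub>R b + v *\<^sub>R a) z < d"
      if "0 \<le> u" "u \<le> s" "0 \<le> v" "v \<le> s" for u v
      using near[of v u] that by (simp add: algebra_simps)
    have inS: "z + u *\<^sub>R a + v *\<^sub>R b \<in> S" "z + u *\<^sub>R b + v *\<^sub>R a \<in> S"
      if "0 \<le> u" "u \<le> s" "0 \<le> v" "v \<le> s" for u v
      using near[OF that] near'[OF that] ball by (auto simp: d_def dist_commute subset_iff)
    obtain \<xi> \<eta> where "0 < \<xi>" "\<xi> < s" "0 < \<eta>" "\<eta> < s"
      and E1: "g (z + s *\<^sub>R a + s *\<^sub>R b) - g (z + s *\<^sub>R a) - g (z + s *\<^sub>R b) + g z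
                 = s\<^sup>2 * g2 (z + \<xi> *\<^sub>R a + \<eta> *\<^sub>R b) b a"
      using second_difference_mean_value[OF s(1) inS(1) d1 d2] by blast
    obtain \<xi>' \<eta>' where "0 < \<xi>'" "\<xi>' < s" "0 < \<eta>'" "\<eta>' < s"
      and E2: "g (z + s *\<^sub>R b + s *\<^sub>R a) - g (z + s *\<^sub>R b) - g (z + s *\<^sub>R a) + g z
                 = s\<^sup>2 * g2 (z + \<xi>' *\<^sub>R b + \<eta>' *\<^sub>R a) a b"
      using second_difference_mean_value[OF s(1) inS(2) d1 d2] by blast
    have "g2 (z + \<xi> *\<^sub>R a + \<eta> *\<^sub>R b) b a = g2 (z + \<xi>' *\<^sub>R b + \<eta>' *\<^sub>R a) a b"
      using E1 E2 s by (simp add: algebra_simps)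
    moreover have "\<bar>g2 (z + \<xi> *\<^sub>R a + \<eta> *\<^sub>R b) b a - g2 z b a\<bar> < e / 2"
      using near[of \<xi> \<eta>] \<open>0 < \<xi>\<close> \<open>\<xi> < s\<close> \<open>0 < \<eta>\<close> \<open>\<eta> < s\<close> by (intro cont_ba) (auto simp: d_def)
    moreover have "\<bar>g2 (z + \<xi>' *\<^sub>R b + \<eta>' *\<^sub>R a) a b - g2 z a b\<bar> < e / 2"
      using near'[of \<xi>' \<eta>'] \<open>0 < \<xi>'\<close> \<open>\<xi>' < s\<close> \<open>0 < \<eta>'\<close> \<open>\<eta>' < s\<close> by (intro cont_ab) (auto simp: d_def)
    ultimately show ?thesis by linarith
  qed
  then show ?thesis using dense_eq0_I[of "g2 z a b - g2 z b a"] by simp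
qed

lemma C2_on_hess_mat_inner:
  fixes F :: "real^'k \<Rightarrow> 'b::euclidean_space"
  assumes "C2_on G F"
  obtains F2 :: "real^'k \<Rightarrow> (real^'k) \<Rightarrow>\<^sub>L ((real^'k) \<Rightarrow>\<^sub>L 'b)"
  where "continuous_on G F2"
    and "\<And>z l i j. z \<in> G \<Longrightarrow> hess_mat (\<lambda>w. l \<bullet> F w) z $ i $ j = l \<bullet> F2 z (axis i 1) (axis j 1)"
    and "\<And>z l. z \<in> G \<Longrightarrow> transpose (hess_mat (\<lambda>w. l \<bullet> F w) z) = hess_mat (\<lambda>w. l \<bullet> F w) z"
proof -
  obtain F1 :: "real^'k \<Rightarrow> (real^'k) \<Rightarrow>\<^sub>L 'b" and F2 where G: "open G"
    and d1: "\<And>w. w \<in> G \<Longrightarrow> (F has_derivative blinfun_apply (F1 w)) (at w)"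
    and d2: "\<And>w. w \<in> G \<Longrightarrow> (F1 has_derivative blinfun_apply (F2 w)) (at w)"
    and c: "continuous_on G F2"
    using assms unfolding C2_on_def by blast
  have D1: "((\<lambda>w. l \<bullet> F w) has_derivative (\<lambda>h. l \<bullet> F1 w h)) (at w)" if "w \<in> G" for w l
    using bounded_linear.has_derivative[OF bounded_linear_inner_right d1[OF that]] .
  have D2: "((\<lambda>w. l \<bullet> F1 w h) has_derivative (\<lambda>k. l \<bullet> F2 w k h)) (at w)" if "w \<in> G" for w l h
    using bounded_linear.has_derivative[OF bounded_linear_inner_right_comp[OF bounded_linear_apply_blinfun] d2[OF that]] .
  have entry: "hess_mat (\<lambda>w. l \<bullet> F w) z $ i $ j = l \<bullet> F2 z (axis i 1) (axis j 1)" if "z \<in> G" for z l i j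
    by (rule hess_mat_eq_derivative[OF G that D1 D2[OF that]])
  have F2_sym: "l \<bullet> F2 z a b = l \<bullet> F2 z b a" if "z \<in> G" for z l a b
  proof (rule second_derivative_symmetric[OF G that D1 D2])
    show "isCont (\<lambda>w. l \<bullet> F2 w a b) z" for a b
      using c G that by (intro continuous_intros) (simp add: continuous_on_eq_continuous_at)
  qed
  have symmetric: "transpose (hess_mat (\<lambda>w. l \<bullet> F w) z) = hess_mat (\<lambda>w. l \<bullet> F w) z"
    if "z \<in> G" for z l
    unfolding transpose_def vec_eq_iff
    by (simp add: entry[OF that] F2_sym[OF that, of l "axis _ 1" "axis _ 1"])
  show thesis by (rule that[OF c entry symmetric])
qed

lemma C2_on_hess_mat_symmetric:
  fixes g :: "real^'k \<Rightarrow> real"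
  assumes "C2_on G g" "z \<in> G"
  shows "transpose (hess_mat g z) = hess_mat g z"
proof -
  obtain F2 :: "real^'k \<Rightarrow> (real^'k) \<Rightarrow>\<^sub>L ((real^'k) \<Rightarrow>\<^sub>L real)"
    where "\<And>z l. z \<in> G \<Longrightarrow> transpose (hess_mat (\<lambda>w. l \<bullet> g w) z) = hess_mat (\<lambda>w. l \<bullet> g w) z"
    by (rule C2_on_hess_mat_inner[OF assms(1)]) auto
  from this[OF assms(2), of 1] show ?thesis by simp
qed

section \<open>Quadratic forms\<close>

lemma symmetric_matrix_inner:
  fixes H :: "real^'k^'k"
  assumes "transpose H = H"
  shows "x \<bullet> (H *v y) = y \<bullet> (H *v x)"
  by (metis assms dot_lmul_matrix inner_commute transpose_matrix_vector)

lemma linear_coeff_eq_0_if_quadratic_nonneg: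
  fixes c d :: real
  assumes "\<And>s. 0 \<le> 2 * s * c + s\<^sup>2 * d"
  shows "c = 0"
proof (rule ccontr)
  assume "c \<noteq> 0"
  define e where "e = \<bar>d\<bar> + 1"
  have e: "e > 0" "d \<le> e" by (simp_all add: e_def add_pos_nonneg)
  have "2 * (- c / e) * c + (- c / e)\<^sup>2 * d \<le> 2 * (- c / e) * c + (- c / e)\<^sup>2 * e"
    using e by (intro add_left_mono mult_left_mono) auto
  also have "\<dots> = - c\<^sup>2 / e" using e by (simp add: power2_eq_square field_simps)
  also have "\<dots> < 0" using \<open>c \<noteq> 0\<close> e by simp
  finally show False using assms[of "- c / e"] by simp
qed

lemma symmetric_psd_form_eq_0_imp_kernel:
  fixes H :: "real^'k^'k"
  assumes sym: "transpose H = H" and psd: "\<And>u. 0 \<le> u \<bullet> (H *v u)" and "v \<bullet> (H *v v) = 0"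
  shows "H *v v = 0"
proof -
  define w where "w = H *v v"
  have "0 \<le> 2 * s * (w \<bullet> w) + s\<^sup>2 * (w \<bullet> (H *v w))" for s
    using psd[of "v + s *\<^sub>R w"] \<open>v \<bullet> (H *v v) = 0\<close> symmetric_matrix_inner[OF sym, of v w]
    by (simp add: w_def matrix_vector_right_distrib matrix_vector_mult_scaleR inner_add_left
        inner_add_right inner_commute power2_eq_square algebra_simps)
  then have "w \<bullet> w = 0" by (rule linear_coeff_eq_0_if_quadratic_nonneg)
  then show ?thesis by (simp add: w_def)
qed

text \<open>The minimum of the Rayleigh quotient over the unit sphere is an eigenvalue.\<close>
lemma quadratic_form_ge_if_eigenvalues_gt:
  fixes H :: "real^'k^'k"
  assumes sym: "transpose H = H" and eig: "\<And>k. mat_eigenvalue H k \<Longrightarrow> \<alpha> < k"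
  shows "\<alpha> * (norm v)\<^sup>2 \<le> v \<bullet> (H *v v)"
proof -
  let ?q = "\<lambda>v. v \<bullet> (H *v v)"
  have "continuous_on (sphere 0 1) ?q"
    by (intro continuous_intros continuous_on_compose2[OF matrix_vector_mult_linear_continuous_on]) auto
  moreover have "sphere (0 :: real^'k) 1 \<noteq> {}" by simp
  ultimately obtain v0 where v0: "v0 \<in> sphere 0 1" and min: "\<And>u. u \<in> sphere 0 1 \<Longrightarrow> ?q v0 \<le> ?q u"
    using continuous_attains_inf[OF compact_sphere] by blast
  define l where "l = ?q v0"
  have lower: "l * (norm u)\<^sup>2 \<le> ?q u" for u
  proof (cases "u = 0")
    case False
    then have "l \<le> ?q (u /\<^sub>R norm u)" unfolding l_def by (intro min) simp
    also have "\<dots> = ?q u / (norm u)\<^sup>2"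
      by (simp add: matrix_vector_mult_scaleR power2_eq_square divide_inverse_commute)
    finally show ?thesis using False by (simp add: field_simps)
  qed simp
  let ?K = "H - l *\<^sub>R mat 1"
  have K_mult: "?K *v u = H *v u - l *\<^sub>R u" for u
    by (simp add: matrix_vector_mult_diff_rdistrib flip: scaleR_matrix_vector_assoc)
  have "?K *v v0 = 0"
  proof (rule symmetric_psd_form_eq_0_imp_kernel)
    show "transpose ?K = ?K" using sym by (simp add: transpose_def vec_eq_iff mat_def)
    show "0 \<le> u \<bullet> (?K *v u)" for u using lower[of u] by (simp add: K_mult inner_diff_right power2_norm_eq_inner)
    show "v0 \<bullet> (?K *v v0) = 0"
      using v0 unfolding K_mult by (simp add: inner_diff_right l_def dot_square_norm)
  qed
  then have "mat_eigenvalue H l"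
    using v0 unfolding mat_eigenvalue_def by (intro exI[of _ v0]) (auto simp: K_mult)
  then have "\<alpha> * (norm v)\<^sup>2 \<le> l * (norm v)\<^sup>2" using eig by (simp add: less_imp_le mult_right_mono)
  then show ?thesis using lower[of v] by linarith
qed

lemma quadratic_form_abs_le_onorm:
  fixes H :: "real^'k^'m"
  shows "\<bar>v \<bullet> (H *v w)\<bar> \<le> onorm ((*v) H) * norm v * norm w"
proof -
  have "\<bar>v \<bullet> (H *v w)\<bar> \<le> norm v * norm (H *v w)" by (rule Cauchy_Schwarz_ineq2)
  also have "\<dots> \<le> norm v * (onorm ((*v) H) * norm w)"
    by (intro mult_left_mono onorm matrix_vector_mul_bounded_linear) simp
  finally show ?thesis by (simp add: mult_ac)
qed

lemma norm_joinxu: "(norm (joinxu x u))\<^sup>2 = (norm x)\<^sup>2 + (norm u)\<^sup>2"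
  by (simp add: power2_norm_eq_inner inner_vec_def joinxu_def UNIV_Plus_UNIV[symmetric] sum.Plus o_def
      del: UNIV_Plus_UNIV)

lemma quadratic_form_joinxu:
  fixes H :: "real^('n::finite + 'm::finite)^('n + 'm)"
  assumes sym: "transpose H = H"
  shows "joinxu x u \<bullet> (H *v joinxu x u)
    = x \<bullet> ((\<chi> i j. H $ Inl i $ Inl j) *v x) + 2 * (x \<bullet> ((\<chi> i j. H $ Inl i $ Inr j) *v u))
      + u \<bullet> ((\<chi> i j. H $ Inr i $ Inr j) *v u)"
proof -
  have split: "sum g (UNIV :: ('n + 'm) set) = sum (g \<circ> Inl) UNIV + sum (g \<circ> Inr) UNIV" for g :: "_ \<Rightarrow> real"
    by (simp add: UNIV_Plus_UNIV[symmetric] sum.Plus del: UNIV_Plus_UNIV)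
  have sym': "H $ Inr i $ Inl j = H $ Inl j $ Inr i" for i j
    using arg_cong[OF sym, of "\<lambda>A. A $ Inr i $ Inl j"] by (simp add: transpose_def)
  have "(\<Sum>i\<in>UNIV. u$i * (\<Sum>j\<in>UNIV. H $ Inr i $ Inl j * x$j))
      = (\<Sum>i\<in>UNIV. \<Sum>j\<in>UNIV. u$i * H $ Inr i $ Inl j * x$j)"
    by (simp add: sum_distrib_left mult.assoc)
  also have "\<dots> = (\<Sum>j\<in>UNIV. \<Sum>i\<in>UNIV. u$i * H $ Inr i $ Inl j * x$j)" by (rule sum.swap)
  also have "\<dots> = (\<Sum>i\<in>UNIV. x$i * (\<Sum>j\<in>UNIV. H $ Inl i $ Inr j * u$j))"
    by (simp add: sum_distrib_left sym' mult.commute mult.left_commute)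
  finally have cross: "(\<Sum>i\<in>UNIV. u$i * (\<Sum>j\<in>UNIV. H $ Inr i $ Inl j * x$j))
      = (\<Sum>i\<in>UNIV. x$i * (\<Sum>j\<in>UNIV. H $ Inl i $ Inr j * u$j))" .
  show ?thesis
    unfolding inner_vec_def matrix_vector_mult_def
    by (simp add: split o_def joinxu_def sum.distrib distrib_left cross)
qed

section \<open>Hessians along the trajectory\<close>

lemma continuous_on_joinxu:
  assumes "continuous_on S x" "continuous_on S u"
  shows "continuous_on S (\<lambda>t. joinxu (x t) (u t))"
  unfolding joinxu_def
proof (rule continuous_on_vec_lambda)
  show "continuous_on S (\<lambda>t. case k of Inl i \<Rightarrow> x t $ i | Inr j \<Rightarrow> u t $ j)" for k
    by (cases k) (auto intro!: continuous_intros assms)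
qed

lemma HessH_symmetric_bounded:
  fixes f :: "real^'n \<Rightarrow> real^'m \<Rightarrow> real^'n"
  assumes cont: "continuous_on {-1..1} xs" "continuous_on {-1..1} us" "continuous_on {-1..1} ls"
    and smooth_f: "C2_on G (\<lambda>z. f (xpart z) (upart z))"
    and traj_in_G: "\<And>t. t \<in> {-1..1} \<Longrightarrow> joinxu (xs t) (us t) \<in> G"
  obtains K where "\<And>t. t \<in> {-1..1} \<Longrightarrow> transpose (HessH f xs us ls t) = HessH f xs us ls t"
    and "\<And>t i j. t \<in> {-1..1} \<Longrightarrow> \<bar>HessH f xs us ls t $ i $ j\<bar> \<le> K"
proof -
  obtain F2 :: "real^('n + 'm) \<Rightarrow> (real^('n + 'm)) \<Rightarrow>\<^sub>L ((real^('n + 'm)) \<Rightarrow>\<^sub>L (real^'n))"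
    where F2: "continuous_on G F2"
    and entry: "\<And>z l i j. z \<in> G \<Longrightarrow>
       hess_mat (\<lambda>w. l \<bullet> f (xpart w) (upart w)) z $ i $ j = l \<bullet> F2 z (axis i 1) (axis j 1)"
    and sym: "\<And>z l. z \<in> G \<Longrightarrow> transpose (hess_mat (\<lambda>w. l \<bullet> f (xpart w) (upart w)) z)
                                   = hess_mat (\<lambda>w. l \<bullet> f (xpart w) (upart w)) z"
    by (rule C2_on_hess_mat_inner[OF smooth_f]) auto
  define z where "z t = joinxu (xs t) (us t)" for t
  have HessH_eq: "HessH f xs us ls t = hess_mat (\<lambda>w. ls t \<bullet> f (xpart w) (upart w)) (z t)" for t
    by (simp add: HessH_def z_def)
  have "continuous_on {-1..1} (\<lambda>t. F2 (z t))"
    unfolding z_def using traj_in_G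
    by (intro continuous_on_compose2[OF F2 continuous_on_joinxu[OF cont(1,2)]]) auto
  then obtain Fb where Fb: "\<And>t. t \<in> {-1..1} \<Longrightarrow> norm (F2 (z t)) \<le> Fb"
    using compact_imp_bounded[OF compact_continuous_image[OF _ compact_Icc]] bounded_iff by (metis imageI)
  obtain Lb where Lb: "\<And>t. t \<in> {-1..1} \<Longrightarrow> norm (ls t) \<le> Lb"
    using compact_imp_bounded[OF compact_continuous_image[OF cont(3) compact_Icc]] bounded_iff by (metis imageI)
  have "\<bar>HessH f xs us ls t $ i $ j\<bar> \<le> Lb * Fb" if t: "t \<in> {-1..1}" for t i j
  proof -
    have "\<bar>HessH f xs us ls t $ i $ j\<bar> \<le> norm (ls t) * norm (F2 (z t) (axis i 1) (axis j 1))"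
      unfolding HessH_eq entry[OF traj_in_G[OF t, folded z_def]] by (rule Cauchy_Schwarz_ineq2)
    also have "\<dots> \<le> norm (ls t) * norm (F2 (z t))"
      using norm_blinfun[of "F2 (z t) (axis i 1)" "axis j 1"] norm_blinfun[of "F2 (z t)" "axis i 1"]
      by (intro mult_left_mono) auto
    also have "\<dots> \<le> Lb * Fb"
      using Lb[OF t] Fb[OF t] by (intro mult_mono) (auto intro: order_trans[OF norm_ge_zero])
    finally show ?thesis .
  qed
  moreover have "transpose (HessH f xs us ls t) = HessH f xs us ls t" if "t \<in> {-1..1}" for t
    unfolding HessH_eq z_def using sym traj_in_G that by blast
  ultimately show thesis using that by blast
qed

section \<open>The quadratic program\<close>

lemma
  shows data_norm_ge_y1: "i \<in> {1..N} \<Longrightarrow> norm (y1 i) \<le> data_norm N y1 y2 y3 y4 y5 y6"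
    and data_norm_ge_y2: "norm y2 \<le> data_norm N y1 y2 y3 y4 y5 y6"
    and data_norm_ge_y4ext: "i \<in> {1..N} \<Longrightarrow> norm (y4ext N y4 y5 i) \<le> data_norm N y1 y2 y3 y4 y5 y6"
    and data_norm_ge_y6: "i \<in> {1..N} \<Longrightarrow> norm (y6 i) \<le> data_norm N y1 y2 y3 y4 y5 y6"
  unfolding data_norm_def y4ext_def by (rule Max_ge; force)+

definition qp_quadratic ::
  "(real^'n \<Rightarrow> real^'m \<Rightarrow> real^'n) \<Rightarrow> (real^'n \<Rightarrow> real)
   \<Rightarrow> (real \<Rightarrow> real^'n) \<Rightarrow> (real \<Rightarrow> real^'m) \<Rightarrow> (real \<Rightarrow> real^'n)
   \<Rightarrow> nat \<Rightarrow> (nat \<Rightarrow> real) \<Rightarrow> (nat \<Rightarrow> real)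
   \<Rightarrow> (nat \<Rightarrow> real^'n) \<Rightarrow> (nat \<Rightarrow> real^'m) \<Rightarrow> real" where
  "qp_quadratic f C xs us ls N tau omega X U =
     X N \<bullet> (hess_mat C (xs 1) *v X N)
     + (\<Sum>i=1..N. omega i *
         (X i \<bullet> (Qmat f xs us ls (tau i) *v X i)
          + 2 * (X i \<bullet> (Smat f xs us ls (tau i) *v U i))
          + U i \<bullet> (Rmat f xs us ls (tau i) *v U i)))"

definition qp_linear ::
  "nat \<Rightarrow> (nat \<Rightarrow> real) \<Rightarrow> (nat \<Rightarrow> real^'n) \<Rightarrow> real^'n \<Rightarrow> (nat \<Rightarrow> real^'m)
   \<Rightarrow> (nat \<Rightarrow> real^'n) \<Rightarrow> (nat \<Rightarrow> real^'m) \<Rightarrow> real" where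
  "qp_linear N omega y4 y5 y6 X U = (\<Sum>i=1..N. omega i * (y4ext N y4 y5 i \<bullet> X i + y6 i \<bullet> U i))"

lemma qp_cost_eq:
  "qp_cost f C xs us ls N tau omega y3 y4 y5 y6 X U
     = qp_quadratic f C xs us ls N tau omega X U / 2
       + X 0 \<bullet> (y3 + (\<Sum>i=1..N. omega i *\<^sub>R y4ext N y4 y5 i)) - qp_linear N omega y4 y5 y6 X U"
  by (simp add: qp_cost_def qp_quadratic_def qp_linear_def Let_def)

text \<open>All feasible points share the initial state \<open>y2\<close>.\<close>
lemma qp_solution_le_feasible:
  assumes "qp_solution f C xs us ls N tau omega y1 y2 y3 y4 y5 y6 X U"
    and "qp_feasible f xs us N tau y1 y2 X' U'"
  shows "qp_quadratic f C xs us ls N tau omega X U / 2 - qp_linear N omega y4 y5 y6 X U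
       \<le> qp_quadratic f C xs us ls N tau omega X' U' / 2 - qp_linear N omega y4 y5 y6 X' U'"
  using assms by (auto simp: qp_solution_def qp_feasible_def qp_cost_eq)

lemma power2_norms_omega:
  assumes "\<And>i. i \<in> {1..N} \<Longrightarrow> 0 \<le> omega i"
  shows "(normX_omega N omega X)\<^sup>2 + (normU_omega N omega U)\<^sup>2
           = (norm (X N))\<^sup>2 + (\<Sum>i=1..N. omega i * ((norm (X i))\<^sup>2 + (norm (U i))\<^sup>2))"
proof -
  have "0 \<le> (\<Sum>i=1..N. omega i * (norm (X i))\<^sup>2)" "0 \<le> (\<Sum>i=1..N. omega i * (norm (U i))\<^sup>2)"
    using assms by (auto intro!: sum_nonneg)
  then show ?thesis unfolding normX_omega_def normU_omega_def by (simp add: ring_distribs sum.distrib)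
qed

lemma qp_quadratic_coercive:
  assumes T: "\<And>v. \<alpha> * (norm v)\<^sup>2 \<le> v \<bullet> (hess_mat C (xs 1) *v v)"
    and H_sym: "\<And>i. i \<in> {1..N} \<Longrightarrow> transpose (HessH f xs us ls (tau i)) = HessH f xs us ls (tau i)"
    and H_pos: "\<And>i w. i \<in> {1..N} \<Longrightarrow> \<alpha> * (norm w)\<^sup>2 \<le> w \<bullet> (HessH f xs us ls (tau i) *v w)"
    and omega: "\<And>i. i \<in> {1..N} \<Longrightarrow> 0 \<le> omega i"
  shows "\<alpha> * ((normX_omega N omega X)\<^sup>2 + (normU_omega N omega U)\<^sup>2)
           \<le> qp_quadratic f C xs us ls N tau omega X U"
proof -
  have pointwise: "\<alpha> * ((norm (X i))\<^sup>2 + (norm (U i))\<^sup>2)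
          \<le> X i \<bullet> (Qmat f xs us ls (tau i) *v X i) + 2 * (X i \<bullet> (Smat f xs us ls (tau i) *v U i))
            + U i \<bullet> (Rmat f xs us ls (tau i) *v U i)" if i: "i \<in> {1..N}" for i
    using H_pos[OF i, of "joinxu (X i) (U i)"]
    unfolding quadratic_form_joinxu[OF H_sym[OF i]] norm_joinxu Qmat_def Smat_def Rmat_def .
  have "(normX_omega N omega X)\<^sup>2 + (normU_omega N omega U)\<^sup>2
      = (norm (X N))\<^sup>2 + (\<Sum>i=1..N. omega i * ((norm (X i))\<^sup>2 + (norm (U i))\<^sup>2))"
    by (rule power2_norms_omega) (rule omega)
  then have "\<alpha> * ((normX_omega N omega X)\<^sup>2 + (normU_omega N omega U)\<^sup>2)
      = \<alpha> * (norm (X N))\<^sup>2 + (\<Sum>i=1..N. omega i * (\<alpha> * ((norm (X i))\<^sup>2 + (norm (U i))\<^sup>2)))"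
    by (simp add: distrib_left sum_distrib_left mult.left_commute)
  also have "\<dots> \<le> qp_quadratic f C xs us ls N tau omega X U"
    unfolding qp_quadratic_def using pointwise omega by (intro add_mono T sum_mono mult_left_mono)
  finally show ?thesis .
qed

lemma abs_inner_le_young:
  fixes x y :: "'a::real_inner"
  assumes "norm y \<le> Y" "0 < \<alpha>"
  shows "\<bar>y \<bullet> x\<bar> \<le> \<alpha> / 4 * (norm x)\<^sup>2 + Y\<^sup>2 / \<alpha>"
proof -
  have "\<bar>y \<bullet> x\<bar> \<le> Y * norm x"
    using Cauchy_Schwarz_ineq2[of y x] assms(1) by (meson mult_right_mono norm_ge_zero order_trans)
  also have "\<dots> \<le> \<alpha> / 4 * (norm x)\<^sup>2 + Y\<^sup>2 / \<alpha>"
    using assms(2) sum_squares_ge_zero[of "\<alpha> * norm x - 2 * Y" 0]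
    by (simp add: field_simps power2_eq_square)
  finally show ?thesis .
qed

lemma qp_linear_bound:
  assumes omega: "\<And>i. i \<in> {1..N} \<Longrightarrow> 0 \<le> omega i" and omega_sum: "(\<Sum>i=1..N. omega i) = 2"
    and \<alpha>: "0 < \<alpha>"
    and y4: "\<And>i. i \<in> {1..N} \<Longrightarrow> norm (y4ext N y4 y5 i) \<le> Y"
    and y6: "\<And>i. i \<in> {1..N} \<Longrightarrow> norm (y6 i) \<le> Y"
  shows "\<bar>qp_linear N omega y4 y5 y6 X U\<bar>
           \<le> \<alpha> / 4 * ((normX_omega N omega X)\<^sup>2 + (normU_omega N omega U)\<^sup>2) + 4 * Y\<^sup>2 / \<alpha>"
proof -
  have summand: "\<bar>omega i * (y4ext N y4 y5 i \<bullet> X i + y6 i \<bullet> U i)\<bar>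
      \<le> omega i * (\<alpha> / 4 * (norm (X i))\<^sup>2 + \<alpha> / 4 * (norm (U i))\<^sup>2 + 2 * (Y\<^sup>2 / \<alpha>))"
    if i: "i \<in> {1..N}" for i
  proof -
    have "\<bar>y4ext N y4 y5 i \<bullet> X i + y6 i \<bullet> U i\<bar>
        \<le> \<alpha> / 4 * (norm (X i))\<^sup>2 + \<alpha> / 4 * (norm (U i))\<^sup>2 + 2 * (Y\<^sup>2 / \<alpha>)"
      using abs_triangle_ineq abs_inner_le_young[OF y4[OF i] \<alpha>, of "X i"]
        abs_inner_le_young[OF y6[OF i] \<alpha>, of "U i"]
      by (smt (verit))
    then show ?thesis using omega[OF i] by (simp add: abs_mult mult_left_mono)
  qed
  have "\<bar>qp_linear N omega y4 y5 y6 X U\<bar>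
      \<le> (\<Sum>i=1..N. omega i * (\<alpha> / 4 * (norm (X i))\<^sup>2 + \<alpha> / 4 * (norm (U i))\<^sup>2 + 2 * (Y\<^sup>2 / \<alpha>)))"
    unfolding qp_linear_def using summand by (intro order_trans[OF sum_abs sum_mono])
  also have "\<dots> = \<alpha> / 4 * (\<Sum>i=1..N. omega i * ((norm (X i))\<^sup>2 + (norm (U i))\<^sup>2))
                  + 2 * (Y\<^sup>2 / \<alpha>) * (\<Sum>i=1..N. omega i)"
    by (simp add: ring_distribs sum.distrib sum_distrib_left sum_distrib_right sum_divide_distrib mult_ac)
  also have "\<dots> \<le> \<alpha> / 4 * ((normX_omega N omega X)\<^sup>2 + (normU_omega N omega U)\<^sup>2) + 4 * Y\<^sup>2 / \<alpha>"
  proof -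
    have "(normX_omega N omega X)\<^sup>2 + (normU_omega N omega U)\<^sup>2
        = (norm (X N))\<^sup>2 + (\<Sum>i=1..N. omega i * ((norm (X i))\<^sup>2 + (norm (U i))\<^sup>2))"
      by (rule power2_norms_omega) (rule omega)
    then show ?thesis using \<alpha> by (simp add: omega_sum[simplified] ring_distribs add_divide_distrib)
  qed
  finally show ?thesis .
qed

lemma qp_quadratic_uncontrolled_le:
  assumes N: "1 \<le> N" and omega: "\<And>i. i \<in> {1..N} \<Longrightarrow> 0 \<le> omega i"
    and omega_sum: "(\<Sum>i=1..N. omega i) = 2"
    and X: "\<And>i. i \<in> {1..N} \<Longrightarrow> norm (X i) \<le> b"
    and Q: "\<And>i. i \<in> {1..N} \<Longrightarrow> onorm ((*v) (Qmat f xs us ls (tau i))) \<le> KQ"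
  shows "qp_quadratic f C xs us ls N tau omega X (\<lambda>_. 0)
           \<le> (onorm ((*v) (hess_mat C (xs 1))) + 2 * KQ) * b\<^sup>2"
proof -
  have bound: "v \<bullet> (H *v v) \<le> K * b\<^sup>2" if "onorm ((*v) H) \<le> K" "norm v \<le> b" for H :: "real^'n^'n" and v K
  proof -
    have "v \<bullet> (H *v v) \<le> onorm ((*v) H) * norm v * norm v"
      using quadratic_form_abs_le_onorm[of v H v] by linarith
    also have "\<dots> \<le> K * b\<^sup>2"
      using that onorm_pos_le[OF matrix_vector_mul_bounded_linear, of H]
      by (simp add: power2_eq_square mult.assoc mult_mono' mult_mono)
    finally show ?thesis .
  qed
  have "(\<Sum>i=1..N. omega i * (X i \<bullet> (Qmat f xs us ls (tau i) *v X i))) \<le> (\<Sum>i=1..N. omega i * (KQ * b\<^sup>2))"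
    using bound[OF Q X] omega by (intro sum_mono mult_left_mono)
  also have "\<dots> = 2 * KQ * b\<^sup>2" by (simp flip: sum_distrib_right omega_sum[simplified])
  finally have "(\<Sum>i=1..N. omega i * (X i \<bullet> (Qmat f xs us ls (tau i) *v X i))) \<le> 2 * KQ * b\<^sup>2" .
  moreover have "X N \<bullet> (hess_mat C (xs 1) *v X N) \<le> onorm ((*v) (hess_mat C (xs 1))) * b\<^sup>2"
    using N by (intro bound order_refl X) auto
  ultimately show ?thesis by (simp add: qp_quadratic_def distrib_right)
qed

lemma qp_linear_uncontrolled_bound:
  assumes omega: "\<And>i. i \<in> {1..N} \<Longrightarrow> 0 \<le> omega i" and omega_sum: "(\<Sum>i=1..N. omega i) = 2"
    and y4: "\<And>i. i \<in> {1..N} \<Longrightarrow> norm (y4ext N y4 y5 i) \<le> Y"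
    and X: "\<And>i. i \<in> {1..N} \<Longrightarrow> norm (X i) \<le> b"
  shows "\<bar>qp_linear N omega y4 y5 y6 X (\<lambda>_. 0)\<bar> \<le> 2 * Y * b"
proof -
  have "\<bar>y4ext N y4 y5 i \<bullet> X i\<bar> \<le> Y * b" if "i \<in> {1..N}" for i
    using y4[OF that] X[OF that]
    by (intro order_trans[OF Cauchy_Schwarz_ineq2] mult_mono) (auto intro: order_trans[OF norm_ge_zero])
  then have "\<bar>qp_linear N omega y4 y5 y6 X (\<lambda>_. 0)\<bar> \<le> (\<Sum>i=1..N. omega i * (Y * b))"
    unfolding qp_linear_def using omega
    by (intro order_trans[OF sum_abs sum_mono]) (simp add: abs_mult mult_left_mono)
  also have "\<dots> = 2 * Y * b" by (simp flip: sum_distrib_right omega_sum[simplified])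
  finally show ?thesis .
qed

lemma qp_feasible_shift:
  fixes f :: "real^'n \<Rightarrow> real^'m \<Rightarrow> real^'n"
  assumes gr: "gauss_radau N tau omega"
    and inv: "\<And>i k. i \<in> {1..N} \<Longrightarrow> k \<in> {1..N} \<Longrightarrow>
                (\<Sum>j\<in>{1..N}. radau_D N tau i j * M j k) = (if i = k then 1 else 0)"
    and V: "\<And>i. i \<in> {1..N} \<Longrightarrow> V i = (\<Sum>j\<in>{1..N}. M i j *\<^sub>R
              (Amat f xs us (tau j) *v V j + (Amat f xs us (tau j) *v y2 + y1 j)))"
  shows "qp_feasible f xs us N tau y1 y2 (\<lambda>j. if j = 0 then y2 else y2 + V j) (\<lambda>_. 0)"
  unfolding qp_feasible_def
proof (intro conjI ballI)
  let ?A = "\<lambda>j. Amat f xs us (tau j)" and ?D = "radau_D N tau"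
  let ?X = "\<lambda>j. if j = 0 then y2 else y2 + V j"
  fix i assume i: "i \<in> {1..N}"
  have "(\<Sum>j=0..N. ?D i j *\<^sub>R ?X j) = (\<Sum>j\<in>{1..N}. ?D i j *\<^sub>R V j)"
    using radau_D_row_sum[OF gauss_radau_inj_on[OF gr]] by (simp add: sum_scaleR_eq_sum_differences)
  also have "\<dots> = (\<Sum>j\<in>{1..N}. ?D i j *\<^sub>R
                    (\<Sum>k\<in>{1..N}. M j k *\<^sub>R (?A k *v V k + (?A k *v y2 + y1 k))))"
    using V by (intro sum.cong) auto
  also have "\<dots> = ?A i *v V i + (?A i *v y2 + y1 i)" by (rule sum_scaleR_right_inverse[OF _ i inv]) simp
  also have "\<dots> = ?A i *v ?X i + Bmat f xs us (tau i) *v 0 + y1 i"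
    using i by (simp add: matrix_vector_right_distrib algebra_simps)
  finally show "(\<Sum>j=0..N. ?D i j *\<^sub>R ?X j) = ?A i *v ?X i + Bmat f xs us (tau i) *v 0 + y1 i" .
qed simp

text \<open>With \<open>m = 2\<close> from (P1) and \<open>a = 1/4\<close> from (A3), the shift has maximum norm at most
  \<open>m (5/4) Y / (1 - m a) = 5 Y\<close>.\<close>
lemma qp_feasible_uncontrolled:
  fixes f :: "real^'n \<Rightarrow> real^'m \<Rightarrow> real^'n"
  assumes gr: "gauss_radau N tau omega" and P1: "radau_P1 N tau"
    and A: "\<And>j. j \<in> {1..N} \<Longrightarrow> mat_norm_inf (Amat f xs us (tau j)) \<le> 1/4"
    and y1: "\<And>j. j \<in> {1..N} \<Longrightarrow> norm (y1 j) \<le> Y" and y2: "norm y2 \<le> Y"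
  obtains X where "qp_feasible f xs us N tau y1 y2 X (\<lambda>_. 0)"
    and "\<And>j. j \<le> N \<Longrightarrow> norm (X j) \<le> (1 + 5 * sqrt CARD('n)) * Y"
proof -
  let ?A = "\<lambda>j. Amat f xs us (tau j)"
  define r where "r j = ?A j *v y2 + y1 j" for j
  have r: "infnorm (r j) \<le> 5/4 * Y" if "j \<in> {1..N}" for j
  proof -
    have "infnorm (r j) \<le> mat_norm_inf (?A j) * infnorm y2 + infnorm (y1 j)"
      unfolding r_def by (intro order_trans[OF infnorm_triangle] add_mono infnorm_matrix_vector_mult_le) simp
    also have "\<dots> \<le> 1/4 * Y + Y"
      using A[OF that] y1[OF that] y2 infnorm_le_norm[of y2] infnorm_le_norm[of "y1 j"] infnorm_pos_le[of y2]
      by (intro add_mono mult_mono) auto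
    finally show ?thesis by simp
  qed
  obtain M where inv: "\<And>i k. i \<in> {1..N} \<Longrightarrow> k \<in> {1..N} \<Longrightarrow>
                        (\<Sum>j\<in>{1..N}. radau_D N tau i j * M j k) = (if i = k then 1 else 0)"
    and M: "\<And>i. i \<in> {1..N} \<Longrightarrow> (\<Sum>j\<in>{1..N}. \<bar>M i j\<bar>) \<le> 2"
    using P1 unfolding radau_P1_def by blast
  obtain V where V: "\<And>i. i \<in> {1..N} \<Longrightarrow> V i = (\<Sum>j\<in>{1..N}. M i j *\<^sub>R (?A j *v V j + r j))"
    using affine_fixpoint_exists[of "{1..N}" M 2 ?A "1/4"] M A by auto
  have V_bound: "infnorm (V i) \<le> 2 * (5/4 * Y) / (1 - 2 * (1/4))" if "i \<in> {1..N}" for i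
    by (rule affine_fixpoint_infnorm_le[of "{1..N}" M 2 ?A "1/4" r]) (use M A r V that in auto)
  have "0 \<le> Y" using y2 norm_ge_zero order_trans by blast
  have "norm (if j = 0 then y2 else y2 + V j) \<le> (1 + 5 * sqrt CARD('n)) * Y" if "j \<le> N" for j
  proof (cases "j = 0")
    case False
    then have "j \<in> {1..N}" using that by simp
    have "norm (y2 + V j) \<le> norm y2 + sqrt CARD('n) * infnorm (V j)"
      using norm_le_infnorm[of "V j"] by (simp add: norm_triangle_le)
    also have "\<dots> \<le> Y + sqrt CARD('n) * (5 * Y)"
      using y2 V_bound[OF \<open>j \<in> {1..N}\<close>] by (intro add_mono mult_left_mono) auto
    finally show ?thesis using False by (simp add: algebra_simps)
  next
    case True
    have "Y \<le> (1 + 5 * sqrt CARD('n)) * Y" using \<open>0 \<le> Y\<close> by (simp add: algebra_simps)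
    then show ?thesis using True y2 by simp
  qed
  moreover have "qp_feasible f xs us N tau y1 y2 (\<lambda>j. if j = 0 then y2 else y2 + V j) (\<lambda>_. 0)"
    by (rule qp_feasible_shift[OF gr]) (fact inv, fact V[unfolded r_def])
  ultimately show thesis using that by blast
qed

lemma qp_solution_energy_bound:
  fixes f :: "real^'n \<Rightarrow> real^'m \<Rightarrow> real^'n"
  assumes N: "1 \<le> N" and gr: "gauss_radau N tau omega" and P1: "radau_P1 N tau" and \<alpha>: "0 < \<alpha>"
    and T: "\<And>v. \<alpha> * (norm v)\<^sup>2 \<le> v \<bullet> (hess_mat C (xs 1) *v v)"
    and H_sym: "\<And>t. t \<in> {-1..1} \<Longrightarrow> transpose (HessH f xs us ls t) = HessH f xs us ls t"
    and H_pos: "\<And>t w. t \<in> {-1..1} \<Longrightarrow> \<alpha> * (norm w)\<^sup>2 \<le> w \<bullet> (HessH f xs us ls t *v w)"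
    and Q: "\<And>t. t \<in> {-1..1} \<Longrightarrow> onorm ((*v) (Qmat f xs us ls t)) \<le> KQ"
    and A: "\<And>t. t \<in> {-1..1} \<Longrightarrow> mat_norm_inf (Amat f xs us t) \<le> 1/4"
    and sol: "qp_solution f C xs us ls N tau omega y1 y2 y3 y4 y5 y6 X U"
  defines "Y \<equiv> data_norm N y1 y2 y3 y4 y5 y6" and "K \<equiv> 1 + 5 * sqrt CARD('n)"
  shows "(normX_omega N omega X)\<^sup>2 + (normU_omega N omega U)\<^sup>2
           \<le> 2 / \<alpha> * ((onorm ((*v) (hess_mat C (xs 1))) + 2 * KQ) * K\<^sup>2 + 4 * K + 8 / \<alpha>) * Y\<^sup>2"
proof -
  have tau: "tau i \<in> {-1..1}" if "i \<in> {1..N}" for i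
    using gauss_radau_node_range[OF gr] that by simp
  have omega: "0 \<le> omega i" if "i \<in> {1..N}" for i
    using gauss_radau_weight_pos[OF gr that] by simp
  have omega_sum: "(\<Sum>i=1..N. omega i) = 2" by (rule gauss_radau_weight_sum[OF gr])
  have y4: "norm (y4ext N y4 y5 i) \<le> Y" and y6: "norm (y6 i) \<le> Y" if "i \<in> {1..N}" for i
    unfolding Y_def using that by (rule data_norm_ge_y4ext, rule data_norm_ge_y6)
  obtain Xh where feasible: "qp_feasible f xs us N tau y1 y2 Xh (\<lambda>_. 0)"
    and Xh: "\<And>j. j \<le> N \<Longrightarrow> norm (Xh j) \<le> K * Y"
  proof (rule qp_feasible_uncontrolled[OF gr P1])
    show "mat_norm_inf (Amat f xs us (tau j)) \<le> 1/4" if "j \<in> {1..N}" for j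
      using A tau that by blast
    show "norm (y1 j) \<le> Y" if "j \<in> {1..N}" for j
      unfolding Y_def using that by (rule data_norm_ge_y1)
    show "norm y2 \<le> Y" unfolding Y_def by (rule data_norm_ge_y2)
  qed (use that in \<open>simp add: K_def\<close>)
  let ?E = "(normX_omega N omega X)\<^sup>2 + (normU_omega N omega U)\<^sup>2"
  let ?P = "onorm ((*v) (hess_mat C (xs 1))) + 2 * KQ"
  have "\<alpha> * ?E \<le> qp_quadratic f C xs us ls N tau omega X U"
    by (rule qp_quadratic_coercive) (use T H_sym H_pos tau omega in auto)
  also have "\<dots> \<le> qp_quadratic f C xs us ls N tau omega Xh (\<lambda>_. 0)
                    - 2 * qp_linear N omega y4 y5 y6 Xh (\<lambda>_. 0) + 2 * qp_linear N omega y4 y5 y6 X U"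
    using qp_solution_le_feasible[OF sol feasible] by simp
  also have "\<dots> \<le> ?P * (K * Y)\<^sup>2 + 2 * (2 * Y * (K * Y)) + 2 * (\<alpha> / 4 * ?E + 4 * Y\<^sup>2 / \<alpha>)"
  proof -
    have "qp_quadratic f C xs us ls N tau omega Xh (\<lambda>_. 0) \<le> ?P * (K * Y)\<^sup>2"
      by (rule qp_quadratic_uncontrolled_le) (use N omega omega_sum Xh Q tau in auto)
    moreover have "\<bar>qp_linear N omega y4 y5 y6 Xh (\<lambda>_. 0)\<bar> \<le> 2 * Y * (K * Y)"
      by (rule qp_linear_uncontrolled_bound) (use omega omega_sum y4 Xh in auto)
    moreover have "\<bar>qp_linear N omega y4 y5 y6 X U\<bar> \<le> \<alpha> / 4 * ?E + 4 * Y\<^sup>2 / \<alpha>"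
      by (rule qp_linear_bound) (use omega omega_sum \<alpha> y4 y6 in auto)
    ultimately show ?thesis by (simp add: abs_le_iff)
  qed
  also have "\<dots> = (?P * K\<^sup>2 + 4 * K + 8 / \<alpha>) * Y\<^sup>2 + \<alpha> / 2 * ?E"
    using \<alpha> by (simp add: field_simps power2_eq_square)
  finally show ?thesis using \<alpha> by (simp add: field_simps)
qed

lemma le_sqrt_mult_if_sum_power2_le:
  fixes x y M Y :: real
  assumes "x\<^sup>2 + y\<^sup>2 \<le> M * Y\<^sup>2" "0 \<le> Y"
  shows "x \<le> sqrt M * Y" "y \<le> sqrt M * Y"
proof -
  have "sqrt (M * Y\<^sup>2) = sqrt M * Y" using assms(2) by (simp add: real_sqrt_mult)
  moreover have "x\<^sup>2 \<le> M * Y\<^sup>2" "y\<^sup>2 \<le> M * Y\<^sup>2"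
    using assms(1) zero_le_power2[of x] zero_le_power2[of y] by linarith+
  ultimately show "x \<le> sqrt M * Y" "y \<le> sqrt M * Y" by (metis real_le_rsqrt)+
qed

theorem lemma5p1:
  fixes f :: "real^'n \<Rightarrow> real^'m \<Rightarrow> real^'n"
    and C :: "real^'n \<Rightarrow> real"
    and xs :: "real \<Rightarrow> real^'n" and us :: "real \<Rightarrow> real^'m" and ls :: "real \<Rightarrow> real^'n"
    and G :: "(real^('n + 'm)) set" and GC :: "(real^'n) set"
    and \<alpha> :: real
  assumes cont: "continuous_on {-1..1} xs" "continuous_on {-1..1} us" "continuous_on {-1..1} ls"
    and smooth_f: "C2_on G (\<lambda>z. f (xpart z) (upart z))"
    and traj_in_G: "\<forall>t\<in>{-1..1}. joinxu (xs t) (us t) \<in> G"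
    and smooth_C: "C2_on GC C" and end_in_GC: "xs 1 \<in> GC"
    and A2_pos: "\<alpha> > 0"
    and A2_T: "\<forall>k. mat_eigenvalue (hess_mat C (xs 1)) k \<longrightarrow> k > \<alpha>"
    and A2_H: "\<forall>t\<in>{-1..1}. \<forall>k. mat_eigenvalue (HessH f xs us ls t) k \<longrightarrow> k > \<alpha>"
    and A3: "\<forall>t\<in>{-1..1}. mat_norm_inf (Amat f xs us t) \<le> 1/4
                       \<and> mat_norm_inf (transpose (Amat f xs us t)) \<le> 1/4"
  shows "\<exists>c::real. \<forall>N tau omega.
           N \<ge> 2 \<longrightarrow> gauss_radau N tau omega \<longrightarrow> radau_P1 N tau \<longrightarrow>
           (\<forall>y1 y2 y3 y4 y5 y6 X U.
              qp_solution f C xs us ls N tau omega y1 y2 y3 y4 y5 y6 X U \<longrightarrow>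
                normX_omega N omega X \<le> c * data_norm N y1 y2 y3 y4 y5 y6 \<and>
                normU_omega N omega U \<le> c * data_norm N y1 y2 y3 y4 y5 y6)"
proof -
  let ?T = "hess_mat C (xs 1)"
  have T_pos: "\<alpha> * (norm v)\<^sup>2 \<le> v \<bullet> (?T *v v)" for v
    by (rule quadratic_form_ge_if_eigenvalues_gt[OF C2_on_hess_mat_symmetric[OF smooth_C end_in_GC]])
      (use A2_T in auto)
  obtain K where H_sym: "\<And>t. t \<in> {-1..1} \<Longrightarrow> transpose (HessH f xs us ls t) = HessH f xs us ls t"
    and H_bound: "\<And>t i j. t \<in> {-1..1} \<Longrightarrow> \<bar>HessH f xs us ls t $ i $ j\<bar> \<le> K"
    by (rule HessH_symmetric_bounded[OF cont smooth_f]) (use traj_in_G in auto)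
  have H_pos: "\<alpha> * (norm w)\<^sup>2 \<le> w \<bullet> (HessH f xs us ls t *v w)" if "t \<in> {-1..1}" for t w
    by (rule quadratic_form_ge_if_eigenvalues_gt[OF H_sym[OF that]]) (use A2_H that in auto)
  define KQ where "KQ = real CARD('n) * real CARD('n) * K"
  have Q: "onorm ((*v) (Qmat f xs us ls t)) \<le> KQ" if "t \<in> {-1..1}" for t
    unfolding KQ_def by (rule onorm_le_matrix_component) (simp add: Qmat_def H_bound[OF that])
  define M where "M = 2 / \<alpha> * ((onorm ((*v) ?T) + 2 * KQ) * (1 + 5 * sqrt CARD('n))\<^sup>2
                                  + 4 * (1 + 5 * sqrt CARD('n)) + 8 / \<alpha>)"
  show ?thesis
  proof (intro exI[of _ "sqrt M"] allI impI)
    fix N tau omega y1 y2 y3 y4 y5 y6 X U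
    assume "N \<ge> 2" "gauss_radau N tau omega" "radau_P1 N tau"
      and "qp_solution f C xs us ls N tau omega y1 y2 y3 y4 y5 y6 X U"
    then have "(normX_omega N omega X)\<^sup>2 + (normU_omega N omega U)\<^sup>2
        \<le> M * (data_norm N y1 y2 y3 y4 y5 y6)\<^sup>2"
      unfolding M_def using A2_pos T_pos H_sym H_pos Q A3 by (intro qp_solution_energy_bound) auto
    moreover have "0 \<le> data_norm N y1 y2 y3 y4 y5 y6"
      by (rule order_trans[OF norm_ge_zero data_norm_ge_y2])
    ultimately show "normX_omega N omega X \<le> sqrt M * data_norm N y1 y2 y3 y4 y5 y6 \<and>
                     normU_omega N omega U \<le> sqrt M * data_norm N y1 y2 y3 y4 y5 y6"
      using le_sqrt_mult_if_sum_power2_le by blast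
  qed
qed

end
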